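(* Let $A=(a_{u,v})$ be an $n\times n$ Robinson matrix with entries in $\{0,1,\dots,k\}$ and all diagonal entries equal to $k$. If $A$ has a uniform embedding (with respect to some threshold vector), then there exist a threshold vector $\mathbf d=(d_1,\dots,d_k)\in\mathbb D^k$ and a uniform embedding $\Pi:[n]\to\mathbb R$ of $A$ with respect to $\mathbf d$ which is strictly monotone increasing and for which all the defining inequalities are strict; that is, for all $u,v\in[n]$ with $u<v$ and all $t\in\{0,\dots,k\}$, $$a_{u,v}=t \iff d_{t+1}<\Pi(v)-\Pi(u)<d_t,$$ where here $d_{k+1}=0$ and $d_0=\infty$.
   Context: $[n]=\{1,\dots,n\}$. A Robinson matrix is a symmetric matrix $(a_{i,j})$ such that for all $u<v<w$, $a_{u,v}\ge a_{u,w}$ and $a_{v,w}\ge a_{u,w}$. $\mathbb D^k=\{\mathbf d\in\mathbb R^k: d_1>d_2>\dots>d_k>0\}$. Given such a matrix $A$ and $\mathbf d\in\mathbb D^k$, a map $\Pi:[n]\to\mathbb R$ is a uniform embedding of $A$ with respect to $\mathbf d$ if for every pair $u,v\in[n]$ and every $t\in\{0,\dots,k\}$: $a_{u,v}=t \iff d_{t+1}<|\Pi(v)-\Pi(u)|\le d_t$, where in this definition $d_{k+1}=-\infty$ and $d_0=\infty$. *)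

theory Defs
  imports Complex_Main "HOL-Library.Extended_Real"
begin

text \<open>
  The index set of all matrices is \<open>{1..n}\<close>; matrices, embeddings and threshold vectors are
  total functions whose values outside their index sets are irrelevant.
\<close>

definition robinson :: "nat \<Rightarrow> (nat \<Rightarrow> nat \<Rightarrow> 'a::linorder) \<Rightarrow> bool" where
  "robinson n a \<longleftrightarrow>
     (\<forall>u\<in>{1..n}. \<forall>v\<in>{1..n}. a u v = a v u) \<and>
     (\<forall>u\<in>{1..n}. \<forall>v\<in>{1..n}. \<forall>w\<in>{1..n}. u < v \<and> v < w \<longrightarrow>
        a u v \<ge> a u w \<and> a v w \<ge> a u w)"

definition threshold_vectors :: "nat \<Rightarrow> (nat \<Rightarrow> real) set" where
  "threshold_vectors k =
     {d. (\<forall>i\<in>{1..<k}. d i > d (Suc i)) \<and> (\<forall>i\<in>{1..k}. d i > 0)}"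

text \<open>
  Extension of \<open>d 1, \<dots>, d k\<close> by the values \<open>\<infinity>\<close> at index \<open>0\<close> and \<open>b\<close> at index \<open>k + 1\<close>.
  The bottom value \<open>b\<close> is \<open>-\<infinity>\<close> in the definition of a uniform embedding and \<open>0\<close> for strict
  inequalities between distinct points.
\<close>

definition ext_threshold :: "ereal \<Rightarrow> nat \<Rightarrow> (nat \<Rightarrow> real) \<Rightarrow> nat \<Rightarrow> ereal" where
  "ext_threshold b k d t = (if t = 0 then \<infinity> else if t \<le> k then ereal (d t) else b)"

definition uniform_embedding ::
  "nat \<Rightarrow> nat \<Rightarrow> (nat \<Rightarrow> nat \<Rightarrow> nat) \<Rightarrow> (nat \<Rightarrow> real) \<Rightarrow> (nat \<Rightarrow> real) \<Rightarrow> bool" where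
  "uniform_embedding n k a d \<Pi> \<longleftrightarrow>
     (\<forall>u\<in>{1..n}. \<forall>v\<in>{1..n}. \<forall>t\<in>{0..k}.
        a u v = t \<longleftrightarrow>
          ext_threshold (- \<infinity>) k d (t + 1) < ereal \<bar>\<Pi> v - \<Pi> u\<bar> \<and>
          ereal \<bar>\<Pi> v - \<Pi> u\<bar> \<le> ext_threshold (- \<infinity>) k d t)"

end

theory Submission imports Defs begin

text \<open>
  After a small perturbation \<open>\<Pi>\<close> is injective and all inequalities are strict.  The matrix is then
  Robinson for two linear orders, the given one and the one induced by \<open>\<Pi>\<close>.  If
  \<open>a x z > min (a x y) (a z y)\<close>, then \<open>y\<close> cannot lie between \<open>x\<close> and \<open>z\<close> in either order, so the pairs
  \<open>(x, y)\<close> and \<open>(z, y)\<close> are both inverted by \<open>\<Pi>\<close> or both not inverted; this generates classes of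
  linked pairs, in the style of Gallai's implication classes.  The set \<open>S\<close> of points occurring in the
  class of an inverted pair that is consecutive for \<open>\<Pi>\<close> is an interval for \<open>\<Pi>\<close>, and every point
  outside \<open>S\<close> has a constant label towards \<open>S\<close>.  Hence \<open>\<Pi>\<close> may be changed on \<open>S\<close> arbitrarily as
  long as \<open>S\<close> stays embedded within its convex hull.  If \<open>S\<close> is a proper subset, it is sorted by
  induction.  If \<open>S\<close> is everything, \<open>\<Pi>\<close> is reflected; since two classes that both cover everything
  have a common pair, no such class is inverted after the reflection.
\<close>

section \<open>Linked pairs\<close>

text \<open>The order is pulled back along \<open>f\<close>, so that the given order
  (\<open>f\<close> the identity) and the order of an embedding fall under one notion.\<close>

definition robinson_wrt :: "'v set \<Rightarrow> ('v \<Rightarrow> 'v \<Rightarrow> 'l::linorder) \<Rightarrow> ('v \<Rightarrow> 'b::linorder) \<Rightarrow> bool" where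
  "robinson_wrt V a f \<longleftrightarrow> inj_on f V \<and> (\<forall>x\<in>V. \<forall>y\<in>V. a x y = a y x) \<and>
     (\<forall>x\<in>V. \<forall>y\<in>V. \<forall>w\<in>V. f x < f w \<and> f w < f y \<longrightarrow> a x y \<le> a x w \<and> a x y \<le> a w y)"

lemma robinson_wrtD:
  assumes "robinson_wrt V a f" "x \<in> V" "w \<in> V" "y \<in> V" "f x < f w" "f w < f y"
  shows "a x y \<le> a x w" "a x y \<le> a w y"
  using assms unfolding robinson_wrt_def by blast+

lemma robinson_wrt_sym: "robinson_wrt V a f \<Longrightarrow> x \<in> V \<Longrightarrow> y \<in> V \<Longrightarrow> a x y = a y x"
  unfolding robinson_wrt_def by blast

lemma robinson_wrt_neq: "robinson_wrt V a f \<Longrightarrow> x \<in> V \<Longrightarrow> y \<in> V \<Longrightarrow> x \<noteq> y \<Longrightarrow> f x < f y \<or> f y < f x"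
  unfolding robinson_wrt_def by (metis inj_onD neqE)

lemma robinson_wrt_subset: "robinson_wrt V a f \<Longrightarrow> S \<subseteq> V \<Longrightarrow> robinson_wrt S a f"
  unfolding robinson_wrt_def by (meson inj_on_subset subsetD)

text \<open>With \<open>y\<close> between \<open>x\<close> and \<open>z\<close>, the label
  \<open>a x z\<close> would be at most both labels at \<open>y\<close>, hence at most their
  minimum.\<close>

lemma robinson_wrt_extreme:
  assumes R: "robinson_wrt V a f" and V: "x \<in> V" "y \<in> V" "z \<in> V" "x \<noteq> y" "z \<noteq> y"
    and gt: "min (a x y) (a z y) < a x z"
  shows "f x < f y \<longleftrightarrow> f z < f y"
proof (rule ccontr)
  assume "\<not> ?thesis"
  then have "f x < f y \<and> f y < f z \<or> f z < f y \<and> f y < f x"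
    using robinson_wrt_neq[OF R] V by blast
  then have "a x z \<le> a x y \<and> a x z \<le> a z y"
    using robinson_wrtD[OF R, of x y z] robinson_wrtD[OF R, of z y x]
      robinson_wrt_sym[OF R] V(1-3) by metis
  then show False using gt by (auto simp: min_less_iff_disj)
qed

text \<open>A step replaces one point and keeps the other. Since swaps are included, a class carries
  no orientation of its own; what stays constant on it is whether two orders agree on the
  pair.\<close>

inductive linked :: "'v set \<Rightarrow> ('v \<Rightarrow> 'v \<Rightarrow> 'l::linorder) \<Rightarrow> 'v \<Rightarrow> 'v \<Rightarrow> 'v \<Rightarrow> 'v \<Rightarrow> bool"
  for V a u v where
  linked_refl: "linked V a u v u v"
| linked_swap: "linked V a u v x y \<Longrightarrow> linked V a u v y x"
| linked_step: "linked V a u v x y \<Longrightarrow> z \<in> V \<Longrightarrow> z \<noteq> y \<Longrightarrow> min (a x y) (a z y) < a x z \<Longrightarrow>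
    linked V a u v z y"

definition linked_points :: "'v set \<Rightarrow> ('v \<Rightarrow> 'v \<Rightarrow> 'l::linorder) \<Rightarrow> 'v \<Rightarrow> 'v \<Rightarrow> 'v set" where
  "linked_points V a u v = {x. \<exists>y. linked V a u v x y}"

lemma linked_in:
  assumes "linked V a u v x y" "u \<in> V" "v \<in> V" "u \<noteq> v"
  shows "x \<in> V \<and> y \<in> V \<and> x \<noteq> y"
  using assms by induction auto

lemma linked_points_subset: "u \<in> V \<Longrightarrow> v \<in> V \<Longrightarrow> u \<noteq> v \<Longrightarrow> linked_points V a u v \<subseteq> V"
  unfolding linked_points_def using linked_in by fastforce

lemma linked_pointsI: "linked V a u v x y \<Longrightarrow> x \<in> linked_points V a u v \<and> y \<in> linked_points V a u v"
  unfolding linked_points_def using linked_swap by fastforce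

text \<open>A step from \<open>(x, y)\<close> to \<open>(z, y)\<close> stays on one side of
  \<open>y\<close> in both orders, by \<open>robinson_wrt_extreme\<close>, and a swap reverses both
  comparisons.\<close>

lemma linked_orientation:
  assumes "linked V a u v x y" "robinson_wrt V a f" "robinson_wrt V a g" "u \<in> V" "v \<in> V" "u \<noteq> v"
  shows "(f x < f y \<longleftrightarrow> g x < g y) \<longleftrightarrow> (f u < f v \<longleftrightarrow> g u < g v)"
  using assms
proof induction
  case (linked_swap x y)
  then have "x \<in> V" "y \<in> V" "x \<noteq> y" using linked_in by metis+
  then have "f y < f x \<longleftrightarrow> \<not> f x < f y" "g y < g x \<longleftrightarrow> \<not> g x < g y"
    using robinson_wrt_neq linked_swap.prems by (metis order_less_asym)+
  then show ?case using linked_swap by blast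
next
  case (linked_step x y z)
  then have "x \<in> V" "y \<in> V" "x \<noteq> y" using linked_in by metis+
  then have "f x < f y \<longleftrightarrow> f z < f y" "g x < g y \<longleftrightarrow> g z < g y"
    using robinson_wrt_extreme linked_step by metis+
  then show ?case using linked_step by blast
qed auto

section \<open>Points outside a class: constant labels and constant side\<close>

text \<open>Replacing \<open>x\<close> by \<open>w\<close> in the pair must be blocked, or
  \<open>w\<close> would enter the class; hence \<open>a x w\<close> is at most \<open>a x y\<close>
  and \<open>a w y\<close>. The swapped pair gives the reverse inequality between
  \<open>a w x\<close> and \<open>a w y\<close>.\<close>

lemma not_linked_label:
  assumes sym: "\<forall>x\<in>V. \<forall>y\<in>V. a x y = a y x" and uv: "u \<in> V" "v \<in> V" "u \<noteq> v"
    and w: "w \<in> V" "w \<notin> linked_points V a u v" and L: "linked V a u v x y"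
  shows "a w x = a w y \<and> a w x \<le> a x y"
proof -
  have *: "a w p \<le> a w q \<and> a w p \<le> a p q" if "linked V a u v p q" for p q
  proof -
    have pq: "p \<in> V" "q \<in> V" using linked_in[OF that uv] by auto
    have "w \<noteq> q" using w linked_pointsI[OF that] by blast
    then have "\<not> min (a p q) (a w q) < a p w"
      using linked_step[OF that w(1)] linked_pointsI w(2) by metis
    then have "a p w \<le> a p q \<and> a p w \<le> a w q" by (simp add: not_less)
    then show ?thesis using sym pq w by metis
  qed
  have "x \<in> V" "y \<in> V" using linked_in[OF L uv] by auto
  then show ?thesis using *[OF L] *[OF linked_swap[OF L]] sym by auto
qed

text \<open>Successive pairs of a derivation share a point, so the equality of labels inside each
  pair propagates to the whole class.\<close>

lemma linked_points_module:
  assumes sym: "\<forall>x\<in>V. \<forall>y\<in>V. a x y = a y x" and uv: "u \<in> V" "v \<in> V" "u \<noteq> v"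
    and w: "w \<in> V" "w \<notin> linked_points V a u v" and x: "x \<in> linked_points V a u v"
  shows "a w x = a w u"
proof -
  have "a w x = a w u \<and> a w y = a w u" if "linked V a u v x y" for x y
    using that
  proof induction
    case linked_refl
    then show ?case using not_linked_label[OF sym uv w] linked.linked_refl by metis
  next
    case (linked_step x y z)
    then show ?case
      using not_linked_label[OF sym uv w, of z y] linked.linked_step by metis
  qed auto
  then show ?thesis using x unfolding linked_points_def by blast
qed

text \<open>No step crosses \<open>w\<close>: for a step from \<open>x\<close> to \<open>z\<close>,
  the labels \<open>a w x = a w z\<close> are at most both labels at \<open>y\<close> and so below
  \<open>a x z\<close>, which rules out \<open>w\<close> between \<open>x\<close> and
  \<open>z\<close>. The starting pair is not separated by \<open>w\<close> because it is
  consecutive.\<close>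

lemma linked_points_interval:
  assumes R: "robinson_wrt V a f" and uv: "u \<in> V" "v \<in> V" "u \<noteq> v"
    and consecutive: "\<And>w. w \<in> V \<Longrightarrow> \<not> (f u < f w \<and> f w < f v)" "f u < f v"
    and w: "w \<in> V" "w \<notin> linked_points V a u v" and x: "x \<in> linked_points V a u v"
  shows "f x < f w \<longleftrightarrow> f u < f w"
proof -
  have sym: "\<forall>x\<in>V. \<forall>y\<in>V. a x y = a y x" using R unfolding robinson_wrt_def by blast
  have out: "f w < f x \<longleftrightarrow> \<not> f x < f w" if "x \<in> linked_points V a u v" for x
    using that w linked_points_subset[OF uv] robinson_wrt_neq[OF R]
    by (metis order_less_asym subsetD)
  have "(f x < f w \<longleftrightarrow> f u < f w) \<and> (f y < f w \<longleftrightarrow> f u < f w)" if "linked V a u v x y" for x y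
    using that
  proof induction
    case linked_refl
    then show ?case
      using consecutive w linked_pointsI[OF linked.linked_refl] out
      by (metis order_less_trans)
  next
    case (linked_step x y z)
    have zy: "linked V a u v z y" using linked_step.hyps by (rule linked.linked_step)
    have pts: "x \<in> V" "y \<in> V" "z \<in> V" "x \<in> linked_points V a u v" "z \<in> linked_points V a u v"
      using linked_in[OF linked_step.hyps(1) uv] linked_in[OF zy uv]
        linked_pointsI[OF linked_step.hyps(1)] linked_pointsI[OF zy] by auto
    have "a w x \<le> a x y" "a w x \<le> a z y" "a w x = a w z"
      using not_linked_label[OF sym uv w linked_step.hyps(1)] not_linked_label[OF sym uv w zy] by auto
    then have "a w x < a x z" using linked_step.hyps(4) by (auto simp: min_less_iff_disj)
    then have "\<not> (f x < f w \<and> f w < f z)" "\<not> (f z < f w \<and> f w < f x)"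
      using robinson_wrtD[OF R, of x w z] robinson_wrtD[OF R, of z w x] sym pts w
        \<open>a w x = a w z\<close> by (metis leD)+
    then have "f x < f w \<longleftrightarrow> f z < f w" using out pts by blast
    then show ?case using linked_step.IH by blast
  qed auto
  then show ?thesis using x unfolding linked_points_def by blast
qed

section \<open>Classes covering all points\<close>

text \<open>For symmetric \<open>a\<close> this is a graph, and its reflexive transitive closure
  describes components. It is used with \<open>c\<close> the minimum label of distinct
  points.\<close>

definition above :: "'v set \<Rightarrow> ('v \<Rightarrow> 'v \<Rightarrow> 'l::linorder) \<Rightarrow> 'l \<Rightarrow> 'v rel" where
  "above V a c = {(x, y). x \<in> V \<and> y \<in> V \<and> c < a x y}"

text \<open>No label is below \<open>c\<close>, so the strict inequality of a step forces
  \<open>c < a x z\<close>: the moving point travels along an edge and never leaves its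
  component.\<close>

lemma linked_above_components:
  assumes L: "linked V a u v x y" and uv: "u \<in> V" "v \<in> V" "u \<noteq> v"
    and c: "\<And>x y. x \<in> V \<Longrightarrow> y \<in> V \<Longrightarrow> x \<noteq> y \<Longrightarrow> c \<le> a x y"
  shows "((u, x) \<in> (above V a c)\<^sup>* \<and> (v, y) \<in> (above V a c)\<^sup>*) \<or>
         ((u, y) \<in> (above V a c)\<^sup>* \<and> (v, x) \<in> (above V a c)\<^sup>*)"
  using L
proof induction
  case (linked_step x y z)
  have xy: "x \<in> V" "y \<in> V" "x \<noteq> y" using linked_in[OF linked_step.hyps(1) uv] by auto
  have "c < a x z"
    using linked_step.hyps c[OF xy] c[of z y] xy by (auto simp: min_less_iff_disj)
  then have "(x, z) \<in> above V a c" unfolding above_def using xy linked_step.hyps by auto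
  then show ?case using linked_step.IH by (meson rtrancl.rtrancl_into_rtrancl)
qed auto

text \<open>A partial converse: while the label to the fixed point \<open>y\<close> is at most
  \<open>c\<close>, every edge above \<open>c\<close> is a legitimate step.\<close>

lemma linked_along_above:
  assumes L: "linked V a u v x y" and p: "(x, x') \<in> (above V a c)\<^sup>*"
    and c: "\<And>z. (x, z) \<in> (above V a c)\<^sup>* \<Longrightarrow> z \<noteq> y \<and> a z y \<le> c"
  shows "linked V a u v x' y"
  using p
proof induction
  case (step z z')
  have "a z y \<le> c" "z' \<noteq> y"
    using c[OF step.hyps(1)] c[OF rtrancl.rtrancl_into_rtrancl[OF step.hyps]] by auto
  moreover have "z' \<in> V" "c < a z z'" using step.hyps(2) unfolding above_def by auto
  moreover from calculation have "min (a z y) (a z' y) < a z z'"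
    by (auto simp: min_less_iff_disj intro: le_less_trans)
  ultimately show ?case using linked_step[OF step.IH] by blast
qed (rule L)

text \<open>Otherwise membership in the closed neighbourhood \<open>N\<close> of \<open>M\<close>
  above \<open>c\<close> is constant along the class, hence on all of \<open>V\<close>; but
  \<open>M\<close> belongs to it and \<open>m\<close> does not.\<close>

lemma covering_linked_min_pair:
  assumes uv: "u \<in> V" "v \<in> V" "u \<noteq> v" and cover: "linked_points V a u v = V"
    and sym: "\<forall>x\<in>V. \<forall>y\<in>V. a x y = a y x" and c: "\<And>x y. x \<in> V \<Longrightarrow> y \<in> V \<Longrightarrow> x \<noteq> y \<Longrightarrow> c \<le> a x y"
    and mM: "m \<in> V" "M \<in> V" "m \<noteq> M" "a m M = c"
  shows "\<exists>x y. linked V a u v x y \<and> a x y = c"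
proof (rule ccontr)
  assume none: "\<not> ?thesis"
  define N where "N x \<longleftrightarrow> x = M \<or> c < a x M" for x
  have N_imp: "N x" if L: "linked V a u v x y" and "N y" for x y
  proof (rule ccontr)
    assume "\<not> N x"
    have xy: "x \<in> V" "y \<in> V" "x \<noteq> y" using linked_in[OF L uv] by auto
    then have x: "x \<noteq> M" "a x M = c" using \<open>\<not> N x\<close> c[of x M] mM unfolding N_def by auto
    then have "c < a y M" using \<open>N y\<close> none L unfolding N_def by blast
    \<comment> \<open>The step from \<open>(y, x)\<close> to \<open>(M, x)\<close> is allowed since
      \<open>a M x = c < a y M\<close>; it yields a linked pair with label \<open>c\<close>, which
      was excluded.\<close>
    then have "linked V a u v M x"
      using linked_step[OF linked_swap[OF L] mM(2)] x sym mM xy by (auto simp: min_less_iff_disj)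
    then show False using none x sym mM xy by metis
  qed
  have "(N x \<longleftrightarrow> N u) \<and> (N y \<longleftrightarrow> N u)" if "linked V a u v x y" for x y
    using that
  proof induction
    case linked_refl
    then show ?case using N_imp linked.linked_refl linked.linked_swap by metis
  next
    case (linked_step x y z)
    then show ?case using N_imp linked.linked_step linked.linked_swap by metis
  qed auto
  then have "N x \<longleftrightarrow> N u" if "x \<in> V" for x
    using cover that unfolding linked_points_def by blast
  then have "N m" using mM N_def by metis
  then show False using mM unfolding N_def by auto
qed

text \<open>A pair with the minimum label can be stretched: by monotonicity, moving an endpoint
  outwards keeps the label at \<open>c\<close>, so a path above \<open>c\<close> can carry it to the
  extreme point. First the upper endpoint goes to \<open>M\<close>, then the lower one to
  \<open>m\<close>.\<close>

lemma connected_linked_extremes: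
  fixes V :: "'v::linorder set"
  assumes R: "robinson_wrt V a (\<lambda>x. x)" and uv: "u \<in> V" "v \<in> V" "u \<noteq> v"
    and conn: "\<And>x y. x \<in> V \<Longrightarrow> y \<in> V \<Longrightarrow> (x, y) \<in> (above V a c)\<^sup>*"
    and c: "\<And>x y. x \<in> V \<Longrightarrow> y \<in> V \<Longrightarrow> x \<noteq> y \<Longrightarrow> c \<le> a x y"
    and L: "linked V a u v x y" and xy: "a x y = c"
    and m: "m \<in> V" "\<And>z. z \<in> V \<Longrightarrow> m \<le> z" and M: "M \<in> V" "\<And>z. z \<in> V \<Longrightarrow> z \<le> M"
  shows "linked V a u v m M"
proof -
  have sym: "\<And>x y. x \<in> V \<Longrightarrow> y \<in> V \<Longrightarrow> a x y = a y x" using robinson_wrt_sym[OF R] by blast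
  have mono: "a x y \<le> a p q" if "x \<in> V" "y \<in> V" "p \<in> V" "q \<in> V" "x \<le> p" "p < q" "q \<le> y" for x y p q
  proof -
    have "a x y \<le> a x q" using robinson_wrtD(1)[OF R, of x q y] that by (cases "q = y") auto
    also have "\<dots> \<le> a p q" using robinson_wrtD(2)[OF R, of x p q] that by (cases "x = p") auto
    finally show ?thesis .
  qed
  have extend: "linked V a u v x M"
    if L: "linked V a u v x y" and xy: "a x y = c" "x < y" for x y
  proof -
    have V: "x \<in> V" "y \<in> V" using linked_in[OF L uv] by auto
    have far: "a x z = c" if "z \<in> V" "y \<le> z" for z
      using mono[of x z x y] c[of x z] xy V that by auto
    \<comment> \<open>Clamping a path from \<open>y\<close> to \<open>M\<close> at \<open>y\<close> keeps its steps above level \<open>c\<close>.\<close>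
    have "linked V a u v x (max z y)" if "(y, z) \<in> (above V a c)\<^sup>*" for z
      using that
    proof induction
      case (step z z')
      have z: "z \<in> V" "z' \<in> V" "c < a z z'" using step.hyps unfolding above_def by auto
      define p q where "p = max z y" and "q = max z' y"
      have pq: "p \<in> V" "q \<in> V" "y \<le> p" "y \<le> q" using z V unfolding p_def q_def max_def by auto
      have Lp: "linked V a u v p x" using step.IH linked_swap unfolding p_def by metis
      have "linked V a u v q x"
      proof (cases "p = q")
        case False
        \<comment> \<open>A clamped step that does not collapse spans a subinterval of the original
          one, so its label is no smaller.\<close>
        have "a z z' \<le> a p q"
        proof (cases "z < z'")
          case True
          have "p < q" using True False unfolding p_def q_def max_def by (auto split: if_splits)
          moreover have "q = z'" using \<open>p < q\<close> unfolding p_def q_def max_def by (auto split: if_splits)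
          moreover have "z \<le> p" unfolding p_def by simp
          ultimately show ?thesis using mono[of z z' p q] z pq by simp
        next
          case False': False
          have "q < p" using False' False unfolding p_def q_def max_def by (auto split: if_splits)
          moreover have "p = z" using \<open>q < p\<close> unfolding p_def q_def max_def by (auto split: if_splits)
          moreover have "z' \<le> q" unfolding q_def by simp
          ultimately show ?thesis
            using mono[of z' z q p] z pq sym[of z z'] sym[of p q] by simp
        qed
        then have "c < a p q" using z by auto
        moreover have "a p x = c" using far pq sym V by metis
        ultimately show ?thesis
          using linked_step[OF Lp pq(2)] xy pq by (auto simp: min_less_iff_disj)
      qed (use Lp in simp)
      then show ?case using linked_swap unfolding q_def by metis
    qed (use L in simp)
    then have "linked V a u v x (max M y)" using conn V M by blast
    then show ?thesis using M V by (simp add: max_absorb1)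
  qed
  have extend': "linked V a u v m y"
    if L: "linked V a u v x y" and xy: "a x y = c" "x < y" for x y
  proof -
    have V: "x \<in> V" "y \<in> V" using linked_in[OF L uv] by auto
    have far: "a z y = c" if "z \<in> V" "z \<le> x" for z
      using mono[of z y x y] c[of z y] xy V that by auto
    \<comment> \<open>Mirror image of the previous argument: the path now runs from \<open>x\<close>
      down to \<open>m\<close> and is clamped at \<open>x\<close>.\<close>
    have "linked V a u v (min z x) y" if "(x, z) \<in> (above V a c)\<^sup>*" for z
      using that
    proof induction
      case (step z z')
      have z: "z \<in> V" "z' \<in> V" "c < a z z'" using step.hyps unfolding above_def by auto
      define p q where "p = min z x" and "q = min z' x"
      have pq: "p \<in> V" "q \<in> V" "p \<le> x" "q \<le> x" using z V unfolding p_def q_def min_def by auto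
      have Lp: "linked V a u v p y" using step.IH unfolding p_def by metis
      have "linked V a u v q y"
      proof (cases "p = q")
        case False
        have "a z z' \<le> a p q"
        proof (cases "z < z'")
          case True
          have "p < q" using True False unfolding p_def q_def min_def by (auto split: if_splits)
          moreover have "p = z" using \<open>p < q\<close> unfolding p_def q_def min_def by (auto split: if_splits)
          moreover have "q \<le> z'" unfolding q_def by simp
          ultimately show ?thesis using mono[of z z' p q] z pq by simp
        next
          case False': False
          have "q < p" using False' False unfolding p_def q_def min_def by (auto split: if_splits)
          moreover have "q = z'" using \<open>q < p\<close> unfolding p_def q_def min_def by (auto split: if_splits)
          moreover have "p \<le> z" unfolding p_def by simp
          ultimately show ?thesis
            using mono[of z' z q p] z pq sym[of z z'] sym[of p q] by simp
        qed
        then have "c < a p q" using z by auto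
        moreover have "a p y = c" using far pq by metis
        ultimately show ?thesis
          using linked_step[OF Lp pq(2)] xy pq by (auto simp: min_less_iff_disj)
      qed (use Lp in simp)
      then show ?case unfolding q_def by metis
    qed (use L in simp)
    then have "linked V a u v (min m x) y" using conn V m by blast
    then show ?thesis using m V by (simp add: min_absorb1)
  qed
  have done_if: "linked V a u v m M" if L: "linked V a u v x y" and xy: "a x y = c" "x < y" for x y
  proof -
    have V: "x \<in> V" "y \<in> V" using linked_in[OF L uv] by auto
    have "x < M" using M(2)[OF V(2)] xy by simp
    have "a x M = c" using mono[of x M x y] c[of x M] xy V M \<open>x < M\<close> by fastforce
    then show ?thesis using extend'[OF extend[OF L xy]] \<open>x < M\<close> by blast
  qed
  have V: "x \<in> V" "y \<in> V" "x \<noteq> y" using linked_in[OF L uv] by auto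
  show ?thesis
  proof (cases "x < y")
    case True
    then show ?thesis using done_if L xy by blast
  next
    case False
    then show ?thesis using done_if[OF linked_swap[OF L]] xy V sym by auto
  qed
qed

text \<open>Let \<open>c\<close> be the label of the two extreme points, which is the minimum. If
  the graph above \<open>c\<close> is connected, both classes contain the pair of extremes. If not,
  a covering class forces exactly two components and contains every pair across them, in particular
  the starting pair of the other class.\<close>

lemma covering_linked_common_pair:
  fixes V :: "'v::linorder set"
  assumes fin: "finite V" and R: "robinson_wrt V a (\<lambda>x. x)"
    and uv: "u \<in> V" "v \<in> V" "u \<noteq> v" and cover: "linked_points V a u v = V"
    and uv': "u' \<in> V" "v' \<in> V" "u' \<noteq> v'" and cover': "linked_points V a u' v' = V"
  shows "\<exists>x y. linked V a u v x y \<and> linked V a u' v' x y"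
proof -
  have sym: "\<forall>x\<in>V. \<forall>y\<in>V. a x y = a y x" using robinson_wrt_sym[OF R] by blast
  define m M where "m = Min V" and "M = Max V"
  have m: "m \<in> V" "\<And>z. z \<in> V \<Longrightarrow> m \<le> z" and M: "M \<in> V" "\<And>z. z \<in> V \<Longrightarrow> z \<le> M"
    unfolding m_def M_def using fin uv by (auto intro!: Min_in Max_in)
  have "m \<noteq> M" using m M uv by (metis antisym)
  define c where "c = a m M"
  have c_lt: "c \<le> a x y" if "x \<in> V" "y \<in> V" "x < y" for x y
  proof -
    have "m < y" "x \<le> M" using m M that by (meson le_less_trans)+
    then have "a m M \<le> a m y"
      using robinson_wrtD(1)[OF R, of m y M] m M that by (cases "y = M") (auto simp: less_le)
    also have "\<dots> \<le> a x y"
      using robinson_wrtD(2)[OF R, of m x y] m M that by (cases "x = m") (auto simp: less_le)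
    finally show ?thesis unfolding c_def .
  qed
  have c: "c \<le> a x y" if "x \<in> V" "y \<in> V" "x \<noteq> y" for x y
    using c_lt[of x y] c_lt[of y x] that sym by (cases "x < y") auto
  let ?H = "(above V a c)\<^sup>*"
  have Hsym: "(y, x) \<in> ?H" if "(x, y) \<in> ?H" for x y
  proof -
    have "sym (above V a c)" unfolding above_def sym_def using sym by auto
    then show ?thesis using that sym_rtrancl symD by metis
  qed
  show ?thesis
  proof (cases "\<forall>x\<in>V. \<forall>y\<in>V. (x, y) \<in> ?H")
    case True
    have "linked V a p q m M"
      if pq: "p \<in> V" "q \<in> V" "p \<noteq> q" "linked_points V a p q = V" for p q
    proof -
      obtain x y where "linked V a p q x y" "a x y = c"
        using covering_linked_min_pair[OF pq sym c] m(1) M(1) \<open>m \<noteq> M\<close> c_def by blast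
      then show ?thesis
        using connected_linked_extremes[OF R pq(1-3) _ c] True m M by blast
    qed
    then show ?thesis using uv cover uv' cover' by blast
  next
    case False
    have two: "(p, x) \<in> ?H \<or> (q, x) \<in> ?H"
      if "p \<in> V" "q \<in> V" "p \<noteq> q" "linked_points V a p q = V" "x \<in> V" for p q x
      using that linked_above_components[where a = a and c = c, OF _ that(1-3) c] unfolding linked_points_def by blast
    \<comment> \<open>If \<open>p\<close> and \<open>q\<close> shared a component,
      \<open>two\<close> would put every point into it, against the case assumption.\<close>
    have split: "(p, q) \<notin> ?H" if "p \<in> V" "q \<in> V" "p \<noteq> q" "linked_points V a p q = V" for p q
      using False two[OF that] Hsym by (meson rtrancl_trans)
    have u'v': "(u', v') \<notin> ?H" using split uv' cover' by blast
    have H_imp: "z \<noteq> y \<and> a z y \<le> c" if "(x, y) \<notin> ?H" "(x, z) \<in> ?H" "x \<in> V" "y \<in> V" for x y z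
    proof -
      have "z \<in> V" using that(2,3) by induction (auto simp: above_def)
      then have "(z, y) \<in> above V a c" if "\<not> a z y \<le> c" using that \<open>y \<in> V\<close> unfolding above_def by auto
      then show ?thesis using that by (meson rtrancl.rtrancl_into_rtrancl)
    qed
    \<comment> \<open>Each endpoint is moved inside its own component while the other is fixed;
      labels across components are at most \<open>c\<close>, as \<open>linked_along_above\<close>
      requires.\<close>
    have move: "linked V a u v p q"
      if pq: "(u, p) \<in> ?H" "(v, q) \<in> ?H" "p \<in> V" "q \<in> V" for p q
    proof -
      have uv_split: "(u, v) \<notin> ?H" using split uv cover by blast
      have 1: "linked V a u v p v"
        using linked_along_above[OF linked_refl pq(1)] H_imp[OF uv_split _ uv(1,2)] by blast
      have "(v, p) \<notin> ?H" using uv_split pq Hsym by (meson rtrancl_trans)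
      then have "linked V a u v q p"
        using linked_along_above[OF linked_swap[OF 1] pq(2)] H_imp[OF _ _ uv(2) pq(3)] by blast
      then show ?thesis by (rule linked_swap)
    qed
    have "linked V a u v u' v' \<or> linked V a u v v' u'"
      using two[OF uv cover uv'(1)] two[OF uv cover uv'(2)] u'v' move uv' Hsym
      by (meson rtrancl_trans)
    then show ?thesis using linked_refl linked_swap by metis
  qed
qed

section \<open>Sorting an embedding\<close>

text \<open>\<open>B t\<close> is the set of distances allowed for label \<open>t\<close>; larger
  labels mean smaller distances. Convexity is what leaves room to move points.\<close>

locale bands =
  fixes B :: "'l::linorder \<Rightarrow> real set"
  assumes B_convex: "x \<in> B t \<Longrightarrow> z \<in> B t \<Longrightarrow> x \<le> y \<Longrightarrow> y \<le> z \<Longrightarrow> y \<in> B t"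
    and B_pos: "x \<in> B t \<Longrightarrow> 0 < x"
    and B_decreasing: "x \<in> B s \<Longrightarrow> y \<in> B t \<Longrightarrow> s < t \<Longrightarrow> y < x"
begin

definition embeds :: "'v set \<Rightarrow> ('v \<Rightarrow> 'v \<Rightarrow> 'l) \<Rightarrow> ('v \<Rightarrow> real) \<Rightarrow> bool" where
  "embeds V a f \<longleftrightarrow> (\<forall>u\<in>V. \<forall>v\<in>V. u \<noteq> v \<longrightarrow> \<bar>f u - f v\<bar> \<in> B (a u v))"

text \<open>The values of \<open>g\<close> lie in the convex hull of those of \<open>f\<close>. This
  is the invariant that allows a rearranged subset to be put back among the remaining
  points.\<close>

definition in_hull :: "'v set \<Rightarrow> ('v \<Rightarrow> real) \<Rightarrow> ('v \<Rightarrow> real) \<Rightarrow> bool" where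
  "in_hull V g f \<longleftrightarrow> (\<forall>s\<in>V. \<exists>x\<in>V. \<exists>y\<in>V. f x \<le> g s \<and> g s \<le> f y)"

definition inversions :: "'v::linorder set \<Rightarrow> ('v \<Rightarrow> real) \<Rightarrow> ('v \<times> 'v) set" where
  "inversions V f = {(x, y). x \<in> V \<and> y \<in> V \<and> y < x \<and> f x < f y}"

text \<open>Bands decrease, so a smaller distance never has a smaller label, and passing to a point
  in between shrinks distances. Positivity of the bands gives injectivity.\<close>

lemma embeds_robinson_wrt:
  assumes "embeds V a f" and sym: "\<forall>x\<in>V. \<forall>y\<in>V. a x y = a y x"
  shows "robinson_wrt V a f"
proof -
  have le: "a x y \<le> a p q"
    if "x \<in> V" "y \<in> V" "p \<in> V" "q \<in> V" "x \<noteq> y" "p \<noteq> q" "\<bar>f p - f q\<bar> \<le> \<bar>f x - f y\<bar>" for x y p q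
    using assms(1) that B_decreasing[of "\<bar>f p - f q\<bar>" "a p q" "\<bar>f x - f y\<bar>" "a x y"]
    unfolding embeds_def by fastforce
  have "inj_on f V"
    using assms(1) B_pos unfolding embeds_def inj_on_def by (metis abs_zero diff_self less_irrefl)
  moreover have "a x y \<le> a x w \<and> a x y \<le> a w y"
    if "x \<in> V" "y \<in> V" "w \<in> V" "f x < f w" "f w < f y" for x y w
    using le[of x y x w] le[of x y w y] that by fastforce
  ultimately show ?thesis using sym unfolding robinson_wrt_def by blast
qed

text \<open>For \<open>w\<close> outside \<open>S\<close>, the value \<open>g s\<close> lies between
  two old values of \<open>S\<close> on the same side of \<open>f w\<close>. Their distances to
  \<open>f w\<close> lie in one band because \<open>S\<close> is a module, so convexity puts the new
  distance there too. The second claim keeps track of inversions.\<close>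

lemma embeds_replace_module:
  assumes f: "embeds V a f" and g: "embeds S a g" and hull: "in_hull S g f" and S: "S \<subseteq> V"
    and sym: "\<forall>x\<in>V. \<forall>y\<in>V. a x y = a y x"
    and module: "\<And>w x y. w \<in> V \<Longrightarrow> w \<notin> S \<Longrightarrow> x \<in> S \<Longrightarrow> y \<in> S \<Longrightarrow> a w x = a w y"
    and interval: "\<And>w x y. w \<in> V \<Longrightarrow> w \<notin> S \<Longrightarrow> x \<in> S \<Longrightarrow> y \<in> S \<Longrightarrow> f x < f w \<longleftrightarrow> f y < f w"
  shows "embeds V a (\<lambda>v. if v \<in> S then g v else f v)"
    and "\<And>w s. w \<in> V \<Longrightarrow> w \<notin> S \<Longrightarrow> s \<in> S \<Longrightarrow> (g s < f w \<longleftrightarrow> f s < f w) \<and> (f w < g s \<longleftrightarrow> f w < f s)"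
proof -
  have mixed: "\<bar>f w - g s\<bar> \<in> B (a w s) \<and> (g s < f w \<longleftrightarrow> f s < f w) \<and> (f w < g s \<longleftrightarrow> f w < f s)"
    if w: "w \<in> V" "w \<notin> S" and s: "s \<in> S" for w s
  proof -
    obtain x y where xy: "x \<in> S" "y \<in> S" "f x \<le> g s" "g s \<le> f y"
      using hull s unfolding in_hull_def by blast
    have B: "\<bar>f w - f z\<bar> \<in> B (a w s)" if "z \<in> S" for z
    proof -
      have "z \<in> V" "w \<noteq> z" using that S w by auto
      then have "\<bar>f w - f z\<bar> \<in> B (a w z)" using f w unfolding embeds_def by blast
      then show ?thesis using module[OF w that s] by simp
    qed
    have ne: "f z \<noteq> f w" if "z \<in> S" for z using B_pos[OF B[OF that]] by auto
    show ?thesis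
    proof (cases "f s < f w")
      case True
      then have "f y < f w" "f x < f w" using interval[OF w xy(1) s] interval[OF w xy(2) s] by auto
      then show ?thesis
        using B_convex[OF B[OF xy(2)] B[OF xy(1)], of "\<bar>f w - g s\<bar>"] xy True by auto
    next
      case False
      then have "\<not> f y < f w" "\<not> f x < f w" using interval[OF w xy(1) s] interval[OF w xy(2) s] by auto
      then have "f w < f y" "f w < f x" using ne xy by fastforce+
      then show ?thesis
        using B_convex[OF B[OF xy(1)] B[OF xy(2)], of "\<bar>f w - g s\<bar>"] xy False ne[OF s] by auto
    qed
  qed
  then show "\<And>w s. w \<in> V \<Longrightarrow> w \<notin> S \<Longrightarrow> s \<in> S \<Longrightarrow>
      (g s < f w \<longleftrightarrow> f s < f w) \<and> (f w < g s \<longleftrightarrow> f w < f s)" by blast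
  have mixed': "\<bar>g s - f w\<bar> \<in> B (a s w)" if "w \<in> V" "w \<notin> S" "s \<in> S" for w s
    using mixed[OF that] sym that S by (metis abs_minus_commute subsetD)
  show "embeds V a (\<lambda>v. if v \<in> S then g v else f v)"
    unfolding embeds_def
    using f g mixed mixed' by (auto simp: embeds_def)
qed

section \<open>Inversions and the sorting induction\<close>

lemma finite_inversions: "finite V \<Longrightarrow> finite (inversions V f)"
  unfolding inversions_def by (rule finite_subset[of _ "V \<times> V"]) auto

text \<open>Take an inversion with the smallest gap: a point \<open>w\<close> strictly between would
  form an inversion with \<open>u\<close> or with \<open>v\<close>, of smaller gap.\<close>

lemma consecutive_inversion:
  assumes "finite V" "inversions V f \<noteq> {}"
  shows "\<exists>u v. (u, v) \<in> inversions V f \<and> (\<forall>w\<in>V. \<not> (f u < f w \<and> f w < f v))"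
proof -
  obtain p where p: "p \<in> inversions V f"
    "\<And>q. q \<in> inversions V f \<Longrightarrow> f (snd p) - f (fst p) \<le> f (snd q) - f (fst q)"
    using ex_is_arg_min_if_finite[OF finite_inversions[OF assms(1)] assms(2), of "\<lambda>p. f (snd p) - f (fst p)"]
    unfolding is_arg_min_linorder by blast
  obtain u v where uv: "p = (u, v)" by (cases p)
  have "\<not> (f u < f w \<and> f w < f v)" if "w \<in> V" for w
  proof
    assume w: "f u < f w \<and> f w < f v"
    have "(u, w) \<in> inversions V f \<or> (w, v) \<in> inversions V f"
      using w p(1) that unfolding uv inversions_def by auto
    then show False using p(2) w unfolding uv by force
  qed
  then show ?thesis using p(1) uv by blast
qed

text \<open>The outer induction on \<open>card V\<close> sorts proper modules; the inner one, in
  \<open>no_cover\<close>, runs on the number of inversions. The hull claim is carried along so that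
  sorted modules fit back.\<close>

lemma sort_embedding:
  fixes V :: "'v::linorder set"
  assumes "finite V" "robinson_wrt V a (\<lambda>x. x)" "embeds V a f"
  shows "\<exists>g. embeds V a g \<and> in_hull V g f \<and> inversions V g = {}"
  using assms
proof (induction "card V" arbitrary: V f rule: less_induct)
  case less
  note fin = less.prems(1) and R = less.prems(2) and sort_smaller = less.hyps
  have sym: "\<forall>x\<in>V. \<forall>y\<in>V. a x y = a y x" using robinson_wrt_sym[OF R] by blast
  have no_cover: "\<exists>g. embeds V a g \<and> in_hull V g f \<and> inversions V g = {}"
    if "embeds V a f" "\<And>u v. (u, v) \<in> inversions V f \<Longrightarrow> linked_points V a u v \<noteq> V" for f
    using that
  proof (induction "card (inversions V f)" arbitrary: f rule: less_induct)
    case (less f)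
    have Rf: "robinson_wrt V a f" using embeds_robinson_wrt less.prems(1) sym by blast
    show ?case
    proof (cases "inversions V f = {}")
      case True
      then show ?thesis using less.prems(1) unfolding in_hull_def by blast
    next
      case False
      then obtain u v where uv_inv: "(u, v) \<in> inversions V f"
        and cons: "\<And>w. w \<in> V \<Longrightarrow> \<not> (f u < f w \<and> f w < f v)"
        using consecutive_inversion[OF fin False] by blast
      then have uv: "u \<in> V" "v \<in> V" "u \<noteq> v" "f u < f v" unfolding inversions_def by auto
      define S where "S = linked_points V a u v"
      have S: "S \<subseteq> V" using linked_points_subset[OF uv(1-3)] unfolding S_def .
      have uvS: "u \<in> S" "v \<in> S" using linked_pointsI[OF linked_refl] unfolding S_def by metis+
      have "S \<subset> V" using less.prems(2)[OF uv_inv] S unfolding S_def by blast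
      then have "card S < card V" using fin psubset_card_mono by blast
      moreover have "embeds S a f" using less.prems(1) S unfolding embeds_def by blast
      ultimately obtain g where g: "embeds S a g" "in_hull S g f" "inversions S g = {}"
        using sort_smaller[OF _ finite_subset[OF S fin] robinson_wrt_subset[OF R S]] by blast
      define h where "h = (\<lambda>v. if v \<in> S then g v else f v)"
      have mod: "a w x = a w y" if "w \<in> V" "w \<notin> S" "x \<in> S" "y \<in> S" for w x y
        using that linked_points_module[OF sym uv(1-3)] unfolding S_def by metis
      have int: "f x < f w \<longleftrightarrow> f y < f w" if "w \<in> V" "w \<notin> S" "x \<in> S" "y \<in> S" for w x y
        using that linked_points_interval[OF Rf uv(1-3) cons uv(4)] unfolding S_def by metis
      note rep = embeds_replace_module[OF less.prems(1) g(1,2) S sym mod int]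
      have h: "embeds V a h" using rep(1) unfolding h_def by blast
      \<comment> \<open>Pairs inside \<open>S\<close> are sorted and all other pairs keep their
        order, so no inversion is created and \<open>(u, v)\<close>, inside \<open>S\<close>,
        disappears.\<close>
      have sub: "inversions V h \<subseteq> inversions V f - {(u, v)}"
      proof -
        have "(x, y) \<in> inversions V f - {(u, v)}" if "(x, y) \<in> inversions V h" for x y
        proof -
          have xy: "x \<in> V" "y \<in> V" "y < x" "h x < h y" using that unfolding inversions_def by auto
          then have "\<not> (x \<in> S \<and> y \<in> S)"
            using g(3) unfolding inversions_def h_def by auto
          moreover from this have "f x < f y" using xy rep(2) unfolding h_def by (auto split: if_splits)
          ultimately show ?thesis using xy uvS unfolding inversions_def by auto
        qed
        then show ?thesis by auto
      qed
      then have "inversions V h \<subset> inversions V f" using uv_inv by blast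
      then have "card (inversions V h) < card (inversions V f)"
        using psubset_card_mono[OF finite_inversions[OF fin]] by blast
      \<comment> \<open>Classes depend on \<open>a\<close> alone and \<open>h\<close> has no new
        inversions, so the covering assumption passes from \<open>f\<close> to
        \<open>h\<close>.\<close>
      then obtain g' where g': "embeds V a g'" "in_hull V g' h" "inversions V g' = {}"
        using less.hyps[OF _ h] less.prems(2) sub by blast
      have hull: "\<exists>x\<in>V. \<exists>y\<in>V. f x \<le> h s \<and> h s \<le> f y" if "s \<in> V" for s
      proof (cases "s \<in> S")
        case True
        then obtain x y where "x \<in> S" "y \<in> S" "f x \<le> g s" "g s \<le> f y"
          using g(2) unfolding in_hull_def by blast
        then show ?thesis using S True unfolding h_def by auto
      next
        case False
        then show ?thesis using that unfolding h_def by auto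
      qed
      have "\<exists>x\<in>V. \<exists>y\<in>V. f x \<le> g' s \<and> g' s \<le> f y" if s: "s \<in> V" for s
      proof -
        obtain p q where pq: "p \<in> V" "q \<in> V" "h p \<le> g' s" "g' s \<le> h q"
          using g'(2) s unfolding in_hull_def by blast
        obtain x y where "x \<in> V" "f x \<le> h p" "y \<in> V" "h q \<le> f y"
          using hull[OF pq(1)] hull[OF pq(2)] by blast
        then have "f x \<le> g' s" "g' s \<le> f y" using pq by linarith+
        then show ?thesis using \<open>x \<in> V\<close> \<open>y \<in> V\<close> by blast
      qed
      then have "in_hull V g' f" unfolding in_hull_def by blast
      then show ?thesis using g' by blast
    qed
  qed
  show ?case
  proof (cases "\<exists>u v. (u, v) \<in> inversions V f \<and> linked_points V a u v = V")
    case False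
    then show ?thesis using no_cover less.prems(3) by blast
  next
    case True
    then obtain u v where uv_inv: "(u, v) \<in> inversions V f" and cover: "linked_points V a u v = V" by blast
    then have uv: "u \<in> V" "v \<in> V" "u \<noteq> v" unfolding inversions_def by auto
    have Rf: "robinson_wrt V a f" using embeds_robinson_wrt less.prems(3) sym by blast
    define lo hi where "lo = Min (f ` V)" and "hi = Max (f ` V)"
    \<comment> \<open>Reflection at the midpoint of the hull preserves distances and the hull, and
      exchanges inverted and non-inverted pairs.\<close>
    define h where "h x = lo + hi - f x" for x
    have lohi: "lo \<in> f ` V" "hi \<in> f ` V" "\<And>x. x \<in> V \<Longrightarrow> lo \<le> f x \<and> f x \<le> hi"
      unfolding lo_def hi_def using fin uv(1) by (auto intro!: Min_in Max_in simp del: Min_in Max_in)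
    have h: "embeds V a h"
      using less.prems(3) unfolding embeds_def h_def by (simp add: abs_minus_commute)
    have "linked_points V a u' v' \<noteq> V" if inv: "(u', v') \<in> inversions V h" for u' v'
    proof
      assume cover': "linked_points V a u' v' = V"
      have uv': "u' \<in> V" "v' \<in> V" "u' \<noteq> v'" "v' < u'" "f v' < f u'"
        using inv unfolding inversions_def h_def by auto
      obtain x y where xy: "linked V a u v x y" "linked V a u' v' x y"
        using covering_linked_common_pair[OF fin R uv cover uv'(1-3) cover'] by blast
      \<comment> \<open>Through the common pair, \<open>f\<close> inverts \<open>(u, v)\<close>
        exactly if it inverts \<open>(u', v')\<close>; but \<open>f\<close> inverts the former, and
        its reflection \<open>h\<close> inverts the latter.\<close>
      have "(u < v \<longleftrightarrow> f u < f v) \<longleftrightarrow> (u' < v' \<longleftrightarrow> f u' < f v')"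
        using linked_orientation[OF xy(1) R Rf uv] linked_orientation[OF xy(2) R Rf uv'(1-3)] by blast
      then show False using uv' uv_inv unfolding inversions_def by auto
    qed
    then obtain g where g: "embeds V a g" "in_hull V g h" "inversions V g = {}"
      using no_cover[OF h] by blast
    obtain x y where xy: "x \<in> V" "y \<in> V" "f x = lo" "f y = hi" using lohi by auto
    have "lo \<le> g s \<and> g s \<le> hi" if s: "s \<in> V" for s
    proof -
      obtain p q where "p \<in> V" "q \<in> V" "h p \<le> g s" "g s \<le> h q"
        using g(2) s unfolding in_hull_def by blast
      then show ?thesis using lohi(3)[of p] lohi(3)[of q] unfolding h_def by auto
    qed
    then have "in_hull V g f" unfolding in_hull_def using xy by metis
    then show ?thesis using g by blast
  qed
qed

end

section \<open>Threshold vectors\<close>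

text \<open>The open form of the distance intervals for distinct points, with bottom
  \<open>0\<close> at \<open>t = k\<close> and no upper bound at \<open>t = 0\<close>; empty for
  \<open>t > k\<close>.\<close>

definition band :: "nat \<Rightarrow> (nat \<Rightarrow> real) \<Rightarrow> nat \<Rightarrow> real set" where
  "band k d t = {x. t \<le> k \<and> 0 < x \<and> (t < k \<longrightarrow> d (t + 1) < x) \<and> (0 < t \<longrightarrow> x < d t)}"

lemma threshold_antimono:
  assumes "d \<in> threshold_vectors k" "1 \<le> i" "i \<le> j" "j \<le> k"
  shows "d j \<le> d i"
  using assms(3,4)
proof (induction j rule: dec_induct)
  case (step j)
  then have "d (Suc j) < d j" using assms(1,2) unfolding threshold_vectors_def by auto
  then show ?case using step by auto
qed simp

lemma bands_band: "d \<in> threshold_vectors k \<Longrightarrow> bands (band k d)"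
proof
  fix x y :: real and s t
  assume d: "d \<in> threshold_vectors k" and "x \<in> band k d s" "y \<in> band k d t" "s < t"
  then show "y < x" using threshold_antimono[OF d, of "s + 1" t] unfolding band_def by auto
qed (auto simp: band_def)

lemma finite_positive_lower_bound:
  fixes F :: "real set"
  assumes "finite F"
  shows "\<exists>e>0. \<forall>x\<in>F. 0 < x \<longrightarrow> e \<le> x"
proof -
  let ?G = "insert 1 {x\<in>F. 0 < x}"
  have "0 < Min ?G" "\<forall>x\<in>?G. Min ?G \<le> x" using assms by auto
  then show ?thesis by blast
qed

section \<open>Perturbation to strict inequalities\<close>

text \<open>Raising every threshold by \<open>e\<close> gives the upper bounds slack, while the
  strict lower bounds already have slack on a finite set. Shifting each point by a small multiple of
  its index then separates coinciding points.\<close>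

lemma perturb_embedding:
  assumes d: "d \<in> threshold_vectors k" and bound: "\<forall>u\<in>{1..n}. \<forall>v\<in>{1..n}. a u v \<in> {0..k}"
    and emb: "uniform_embedding n k a d \<Pi>"
  shows "\<exists>d'\<in>threshold_vectors k. \<exists>f. bands.embeds (band k d') {1..n} a f"
proof -
  let ?V = "{1..n}"
  have lower: "d (a u v + 1) < \<bar>\<Pi> v - \<Pi> u\<bar>" if "u \<in> ?V" "v \<in> ?V" "a u v < k" for u v
    using emb bound that unfolding uniform_embedding_def ext_threshold_def by fastforce
  have upper: "\<bar>\<Pi> v - \<Pi> u\<bar> \<le> d (a u v)" if "u \<in> ?V" "v \<in> ?V" "0 < a u v" for u v
    using emb bound that unfolding uniform_embedding_def ext_threshold_def by fastforce
  \<comment> \<open>\<open>F\<close> collects the slacks of the lower bounds and the distances. For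
    \<open>a u v = k\<close> the arbitrary value \<open>d (k + 1)\<close> enters, which can only
    make \<open>e0\<close> smaller.\<close>
  define F where "F = (\<lambda>(u, v). \<bar>\<Pi> v - \<Pi> u\<bar> - d (a u v + 1)) ` (?V \<times> ?V) \<union>
    (\<lambda>(u, v). \<bar>\<Pi> v - \<Pi> u\<bar>) ` (?V \<times> ?V)"
  obtain e0 where e0: "0 < e0" "\<And>x. x \<in> F \<Longrightarrow> 0 < x \<Longrightarrow> e0 \<le> x"
    using finite_positive_lower_bound[of F] unfolding F_def by blast
  \<comment> \<open>Half of the slack pays for the raised threshold, the other half for the
    shift.\<close>
  define e where "e = e0 / 2"
  \<comment> \<open>Indices differ by less than \<open>n + 1\<close>, so distances change by less
    than \<open>e\<close>.\<close>
  define \<delta> where "\<delta> = e / (n + 1)"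
  define d' where "d' i = d i + e" for i
  define f where "f v = \<Pi> v + \<delta> * v" for v :: nat
  have e: "0 < e" "0 < \<delta>" using e0 unfolding e_def \<delta>_def by auto
  have d': "d' \<in> threshold_vectors k"
    using d e unfolding threshold_vectors_def d'_def by (auto intro: add_pos_pos)
  have "\<bar>f u - f v\<bar> \<in> band k d' (a u v)" if uv: "u \<in> ?V" "v \<in> ?V" "u \<noteq> v" for u v
  proof -
    let ?x = "\<bar>\<Pi> v - \<Pi> u\<bar>"
    have "\<bar>\<delta> * (real u - real v)\<bar> = \<delta> * \<bar>real u - real v\<bar>" using e by (simp add: abs_mult)
    also have "\<dots> < \<delta> * (n + 1)" using uv e by (intro mult_strict_left_mono) auto
    also have "\<dots> = e" unfolding \<delta>_def by simp
    finally have "\<bar>\<delta> * (real u - real v)\<bar> < e" .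
    moreover have diff: "f u - f v = \<Pi> u - \<Pi> v + \<delta> * (real u - real v)"
      unfolding f_def by (simp add: algebra_simps)
    ultimately have close: "\<bar>f u - f v\<bar> < ?x + e" "?x - e < \<bar>f u - f v\<bar>" by linarith+
    have "0 < \<bar>f u - f v\<bar>"
    proof (cases "?x = 0")
      case True
      then have "f u - f v = \<delta> * (real u - real v)" using diff by simp
      then show ?thesis using e uv by simp
    next
      case False
      have "?x \<in> F" unfolding F_def using uv by force
      then show ?thesis using e0(2)[of ?x] False close e unfolding e_def by auto
    qed
    moreover have "d' (a u v + 1) < \<bar>f u - f v\<bar>" if "a u v < k"
    proof -
      have "?x - d (a u v + 1) \<in> F" unfolding F_def using uv by force
      then show ?thesis
        using e0(2)[of "?x - d (a u v + 1)"] lower[OF uv(1,2) that] close unfolding e_def d'_def by auto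
    qed
    moreover have "\<bar>f u - f v\<bar> < d' (a u v)" if "0 < a u v"
      using upper[OF uv(1,2) that] close unfolding d'_def by auto
    ultimately show ?thesis using bound uv unfolding band_def by auto
  qed
  then show ?thesis using d' bands.embeds_def[OF bands_band[OF d']] by blast
qed

text \<open>If \<open>s < t\<close>, then \<open>x \<le> d t \<le> d (s + 1) < x\<close>, and
  symmetrically. This recovers the label from the distance.\<close>

lemma threshold_level_unique:
  assumes d: "d \<in> threshold_vectors k" and "s \<le> k" "t \<le> k"
    and s: "s < k \<Longrightarrow> d (s + 1) < x" "0 < s \<Longrightarrow> x \<le> d s"
    and t: "t < k \<Longrightarrow> d (t + 1) < x" "0 < t \<Longrightarrow> x \<le> d t"
  shows "s = t"
  using threshold_antimono[OF d, of "s + 1" t] threshold_antimono[OF d, of "t + 1" s] assms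
  by (cases s t rule: linorder_cases) auto

theorem theorem1:
  fixes n k :: nat and a :: "nat \<Rightarrow> nat \<Rightarrow> nat"
  assumes "robinson n a"
    and "\<forall>u\<in>{1..n}. \<forall>v\<in>{1..n}. a u v \<in> {0..k}"
    and "\<forall>u\<in>{1..n}. a u u = k"
    and "\<exists>d\<in>threshold_vectors k. \<exists>\<Pi>. uniform_embedding n k a d \<Pi>"
  shows "\<exists>d\<in>threshold_vectors k. \<exists>\<Pi>.
           uniform_embedding n k a d \<Pi> \<and>
           strict_mono_on {1..n} \<Pi> \<and>
           (\<forall>u\<in>{1..n}. \<forall>v\<in>{1..n}. u < v \<longrightarrow>
              (\<forall>t\<in>{0..k}. a u v = t \<longleftrightarrow>
                 ext_threshold 0 k d (t + 1) < ereal (\<Pi> v - \<Pi> u) \<and>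
                 ereal (\<Pi> v - \<Pi> u) < ext_threshold 0 k d t))"
proof -
  let ?V = "{1..n}"
  obtain d f where d: "d \<in> threshold_vectors k" and f: "bands.embeds (band k d) ?V a f"
    using perturb_embedding assms(2,4) by blast
  interpret bands "band k d" using d by (rule bands_band)
  have "robinson_wrt ?V a (\<lambda>x. x)"
    unfolding robinson_wrt_def
  proof (intro conjI ballI impI)
    fix x y w assume "x \<in> ?V" "y \<in> ?V" "w \<in> ?V" "x < w \<and> w < y"
    then have "a x y \<le> a x w \<and> a x y \<le> a w y" using assms(1) unfolding robinson_def by metis
    then show "a x y \<le> a x w" "a x y \<le> a w y" by auto
  qed (use assms(1) in \<open>auto simp: robinson_def inj_on_def\<close>)
  then obtain \<Pi> where \<Pi>: "embeds ?V a \<Pi>" "inversions ?V \<Pi> = {}"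
    using sort_embedding[OF finite_atLeastAtMost _ f] by blast
  have lt: "\<Pi> u < \<Pi> v" if "u \<in> ?V" "v \<in> ?V" "u < v" for u v
  proof -
    have "\<bar>\<Pi> u - \<Pi> v\<bar> \<in> band k d (a u v)" using \<Pi>(1) that unfolding embeds_def by auto
    then have "0 < \<bar>\<Pi> u - \<Pi> v\<bar>" by (rule B_pos)
    then show ?thesis using \<Pi>(2) that unfolding inversions_def by fastforce
  qed
  have band: "\<bar>\<Pi> v - \<Pi> u\<bar> \<in> band k d (a u v)" if "u \<in> ?V" "v \<in> ?V" "u \<noteq> v" for u v
    using \<Pi>(1) that unfolding embeds_def by (metis abs_minus_commute)
  have le: "(a u v < k \<longrightarrow> d (a u v + 1) < \<bar>\<Pi> v - \<Pi> u\<bar>) \<and> (0 < a u v \<longrightarrow> \<bar>\<Pi> v - \<Pi> u\<bar> \<le> d (a u v))"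
    if "u \<in> ?V" "v \<in> ?V" for u v
  proof (cases "u = v")
    case True
    \<comment> \<open>On the diagonal the label is \<open>k\<close> and the distance
      \<open>0\<close>, so only \<open>0 \<le> d k\<close> for \<open>k > 0\<close> remains.\<close>
    then show ?thesis using assms(3) that d unfolding threshold_vectors_def by (auto simp: less_imp_le)
  next
    case False
    then show ?thesis using band[OF that] unfolding band_def by auto
  qed
  have level: "a u v = t"
    if "u \<in> ?V" "v \<in> ?V" "t \<le> k" "t < k \<longrightarrow> d (t + 1) < \<bar>\<Pi> v - \<Pi> u\<bar>" "0 < t \<longrightarrow> \<bar>\<Pi> v - \<Pi> u\<bar> \<le> d t" for u v t
    using threshold_level_unique[OF d, of "a u v" t "\<bar>\<Pi> v - \<Pi> u\<bar>"] le that assms(2) by auto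
  have "uniform_embedding n k a d \<Pi>"
    unfolding uniform_embedding_def
  proof (intro ballI)
    fix u v t assume uvt: "u \<in> ?V" "v \<in> ?V" "t \<in> {0..k}"
    show "a u v = t \<longleftrightarrow> ext_threshold (- \<infinity>) k d (t + 1) < ereal \<bar>\<Pi> v - \<Pi> u\<bar> \<and>
      ereal \<bar>\<Pi> v - \<Pi> u\<bar> \<le> ext_threshold (- \<infinity>) k d t"
      using le[OF uvt(1,2)] level[OF uvt(1,2), of t] uvt(3) unfolding ext_threshold_def
      by (auto split: if_splits)
  qed
  moreover have "strict_mono_on ?V \<Pi>" using lt by (simp add: strict_mono_on_def)
  \<comment> \<open>At \<open>t = k\<close> the lower bound is \<open>0\<close>, which holds because
    \<open>\<Pi>\<close> is strictly increasing.\<close>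
  moreover have "a u v = t \<longleftrightarrow> ext_threshold 0 k d (t + 1) < ereal (\<Pi> v - \<Pi> u) \<and>
      ereal (\<Pi> v - \<Pi> u) < ext_threshold 0 k d t"
    if uvt: "u \<in> ?V" "v \<in> ?V" "u < v" "t \<in> {0..k}" for u v t
    using band[OF uvt(1,2)] level[OF uvt(1,2), of t] lt[OF uvt(1-3)] uvt(3,4)
    unfolding ext_threshold_def band_def by (auto split: if_splits)
  ultimately show ?thesis using d by blast
qed

end
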